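(* Let $N\ge 2$, let $U$ be a nonempty set, let $f=(f_1,\dots,f_N)$ with $f_i\colon U\to\mathbb{R}\cup\{+\infty\}$ for $i=1,\dots,N$, and let $Y=f(U)=\{f(u):u\in U\}$. Assume that $Y\subset\mathbb{R}^N$. Then, for almost every $\lambda\in\Delta_N^\circ$ such that $V(\lambda)>-\infty$, the set $\operatorname{AExp}_\lambda(Y)$ contains at most one point.
   Context: $U$ is an arbitrary nonempty set with no further structure. The assumption $Y\subset\mathbb{R}^N$ means that all $f_i$ are finite-valued. The open simplex is $\Delta_N^\circ=\{\lambda\in(0,+\infty)^N:\sum_{i=1}^N\lambda_i=1\}$, and "almost every $\lambda$" is with respect to the natural $(N-1)$-dimensional Lebesgue measure on $\Delta_N^\circ$. For $\lambda\in\Delta_N^\circ$, $V(\lambda)=\inf_{u\in U}\sum_{i=1}^N\lambda_i f_i(u)=\inf_{y\in Y}\lambda\cdot y\in[-\infty,+\infty)$. The set of asymptotically exposed objective vectors is $$\operatorname{AExp}_\lambda(Y)=\bigl\{y\in\mathbb{R}^N:\ \exists (y_k)_{k\in\mathbb{N}}\subset Y\text{ with } y_k\to y\text{ and }\lambda\cdot y_k\to V(\lambda)\bigr\},$$ where convergence $y_k\to y$ is in the Euclidean sense. *)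

theory Defs
  imports "HOL-Analysis.Analysis"
begin

section \<open>The open simplex and its Lebesgue measure\<close>

definition open_simplex :: "(real^'n::finite) set" where
  "open_simplex = {l. (\<forall>i. 0 < l $ i) \<and> (\<Sum>i\<in>UNIV. l $ i) = 1}"

text \<open>
  The hyperplane of vectors with coordinate sum 1 is parametrised by all coordinates except the
  \<open>j\<close>-th one. The \<open>(N-1)\<close>-dimensional Lebesgue measure on it is the image of
  Lebesgue measure under this parametrisation. Euclidean surface measure differs from it by the
  constant factor \<open>sqrt N\<close>.
\<close>

definition simplex_chart :: "'n \<Rightarrow> ('n \<Rightarrow> real) \<Rightarrow> real^'n::finite" where
  "simplex_chart j x = (\<chi> i. if i = j then 1 - (\<Sum>k\<in>UNIV - {j}. x k) else x i)"

definition hyperplane_lebesgue :: "'n \<Rightarrow> (real^'n::finite) measure" where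
  "hyperplane_lebesgue j =
     distr (\<Pi>\<^sub>M i\<in>UNIV - {j}. (lborel :: real measure)) borel (simplex_chart j)"

text \<open>The choice of the coordinate is irrelevant: see \<open>simplex_lebesgue_eq\<close> below.\<close>

definition simplex_lebesgue :: "(real^'n::finite) measure" where
  "simplex_lebesgue = restrict_space (hyperplane_lebesgue (SOME j. True)) open_simplex"

lemma open_simplex_borel: "open_simplex \<in> sets (borel :: (real^'n::finite) measure)"
proof -
  have "open_simplex = (\<Inter>i. {l :: real^'n. 0 < l $ i}) \<inter> {l. (\<Sum>i\<in>UNIV. l $ i) = 1}"
    by (auto simp: open_simplex_def)
  moreover have "open (\<Inter>i. {l :: real^'n. 0 < l $ i})"
    by (intro open_INT ballI open_Collect_less continuous_intros) auto
  moreover have "closed {l :: real^'n. (\<Sum>i\<in>UNIV. l $ i) = 1}"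
    by (intro closed_Collect_eq continuous_intros)
  ultimately show ?thesis by (metis borel_open borel_closed sets.Int)
qed

lemma simplex_chart_measurable:
  "simplex_chart j \<in> (\<Pi>\<^sub>M i\<in>UNIV - {j}. (lborel :: real measure)) \<rightarrow>\<^sub>M borel"
proof -
  have [measurable]: "(\<lambda>x. x k) \<in> (\<Pi>\<^sub>M i\<in>UNIV - {j}. (lborel :: real measure)) \<rightarrow>\<^sub>M borel"
    if "k \<in> UNIV - {j}" for k
    using measurable_component_singleton[OF that, of "\<lambda>_. lborel :: real measure"] by simp
  have "(\<lambda>x. simplex_chart j x $ i) \<in> (\<Pi>\<^sub>M i\<in>UNIV - {j}. (lborel :: real measure)) \<rightarrow>\<^sub>M borel" for i
  proof (cases "i = j")
    case True
    then show ?thesis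
      by (simp add: simplex_chart_def)
  next
    case False
    then show ?thesis by (simp add: simplex_chart_def)
  qed
  then show ?thesis
    by (subst borel_measurable_euclidean_space) (fastforce simp: Basis_vec_def inner_axis)
qed

lemma hyperplane_lebesgue_eq:
  "hyperplane_lebesgue j = (hyperplane_lebesgue k :: (real^'n::finite) measure)"
proof (cases "j = k")
  case False
  define R where "R = UNIV - {j, k}"
  have Uj: "UNIV - {j} = insert k R" and Uk: "UNIV - {k} = insert j R"
    and R: "finite R" "j \<notin> R" "k \<notin> R"
    using False by (auto simp: R_def)
  interpret product_sigma_finite "\<lambda>_::'n. lborel :: real measure"
    by standard
  have emeasure: "emeasure (hyperplane_lebesgue a) A =
      (\<integral>\<^sup>+ x. \<integral>\<^sup>+ t. indicator A (simplex_chart a (x(b := t))) \<partial>lborel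
        \<partial>(\<Pi>\<^sub>M i\<in>R. lborel))"
    if "UNIV - {a} = insert b R" "b \<notin> R" "A \<in> sets borel" for a b :: 'n and A :: "(real^'n) set"
  proof -
    have m: "simplex_chart a \<in> (\<Pi>\<^sub>M i\<in>insert b R. (lborel :: real measure)) \<rightarrow>\<^sub>M borel"
      using simplex_chart_measurable[of a] by (simp only: that(1))
    have ind: "indicator A \<in> borel_measurable borel"
      using that(3) by (rule borel_measurable_indicator)
    have "emeasure (hyperplane_lebesgue a) A =
        (\<integral>\<^sup>+ y. indicator A y \<partial>hyperplane_lebesgue a)"
      by (rule nn_integral_indicator[symmetric]) (simp add: hyperplane_lebesgue_def that(3))
    also have "\<dots> = (\<integral>\<^sup>+ x. indicator A (simplex_chart a x) \<partial>(\<Pi>\<^sub>M i\<in>insert b R. lborel))"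
      unfolding hyperplane_lebesgue_def that(1) by (rule nn_integral_distr[OF m]) (simp add: ind)
    also have "\<dots> = (\<integral>\<^sup>+ x. \<integral>\<^sup>+ t. indicator A (simplex_chart a (x(b := t))) \<partial>lborel
        \<partial>(\<Pi>\<^sub>M i\<in>R. lborel))"
      by (rule product_nn_integral_insert[OF R(1) that(2) measurable_compose[OF m ind]])
    finally show ?thesis .
  qed
  have swap: "simplex_chart k (x(j := t)) = simplex_chart j (x(k := (1 - sum x R) + (-1) * t))"
    for x :: "'n \<Rightarrow> real" and t
  proof -
    have "(\<Sum>i\<in>R. if i = a then s else x i) = sum x R" if "a \<notin> R" for a s
      using that by (intro sum.cong) auto
    note upd = this
    have "simplex_chart k (x(j := t)) $ i =
        simplex_chart j (x(k := (1 - sum x R) + (-1) * t)) $ i" for i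
      using False R by (simp add: simplex_chart_def Uj Uk upd)
    then show ?thesis by (simp add: vec_eq_iff)
  qed
  have *: "(\<lambda>t. indicator A (simplex_chart j (x(k := t)))) \<in> borel_measurable borel"
    if "A \<in> sets borel" "x \<in> space (\<Pi>\<^sub>M i\<in>R. (lborel :: real measure))"
    for A :: "(real^'n) set" and x
  proof -
    have "(\<lambda>t. x(k := t)) \<in> lborel \<rightarrow>\<^sub>M (\<Pi>\<^sub>M i\<in>insert k R. (lborel :: real measure))"
      using that by (intro measurable_fun_upd[where J = R]) auto
    from measurable_compose[OF this simplex_chart_measurable[of j, unfolded Uj]]
    have "(\<lambda>t. simplex_chart j (x(k := t))) \<in> borel \<rightarrow>\<^sub>M borel" by simp
    from measurable_compose[OF this borel_measurable_indicator[OF that(1)]]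
    show ?thesis .
  qed
  show ?thesis
  proof (rule measure_eqI)
    fix A :: "(real^'n) set" assume "A \<in> sets (hyperplane_lebesgue j)"
    then have A: "A \<in> sets borel" by (simp add: hyperplane_lebesgue_def)
    show "emeasure (hyperplane_lebesgue j) A = emeasure (hyperplane_lebesgue k) A"
      unfolding emeasure[OF Uj R(3) A] emeasure[OF Uk R(2) A] swap
    proof (rule nn_integral_cong)
      fix x assume "x \<in> space (\<Pi>\<^sub>M i\<in>R. (lborel :: real measure))"
      from nn_integral_real_affine[OF *[OF A this], of "-1" "1 - sum x R"]
      show "(\<integral>\<^sup>+ t. indicator A (simplex_chart j (x(k := t))) \<partial>lborel) =
        (\<integral>\<^sup>+ t. indicator A (simplex_chart j (x(k := (1 - sum x R) + (-1) * t))) \<partial>lborel)"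
        by simp
    qed
  qed (simp add: hyperplane_lebesgue_def)
qed simp

lemma simplex_lebesgue_eq:
  "simplex_lebesgue = restrict_space (hyperplane_lebesgue j) open_simplex"
  unfolding simplex_lebesgue_def by (subst hyperplane_lebesgue_eq[of _ j]) (rule refl)


section \<open>Objective vectors\<close>

definition objective_set :: "'u set \<Rightarrow> ('n::finite \<Rightarrow> 'u \<Rightarrow> ereal) \<Rightarrow> (ereal^'n) set" where
  "objective_set U f = (\<lambda>u. \<chi> i. f i u) ` U"

definition ereal_vec :: "real^'n::finite \<Rightarrow> ereal^'n" where
  "ereal_vec y = (\<chi> i. ereal (y $ i))"

definition scalar_value :: "'u set \<Rightarrow> ('n::finite \<Rightarrow> 'u \<Rightarrow> ereal) \<Rightarrow> real^'n \<Rightarrow> ereal" where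
  "scalar_value U f l = (INF u\<in>U. \<Sum>i\<in>UNIV. ereal (l $ i) * f i u)"

definition AExp :: "real^'n::finite \<Rightarrow> (real^'n) set \<Rightarrow> (real^'n) set" where
  "AExp l Y = {y. \<exists>ys :: nat \<Rightarrow> real^'n. (\<forall>k. ys k \<in> Y) \<and> ys \<longlonglongrightarrow> y \<and>
     (\<lambda>k. ereal (l \<bullet> ys k)) \<longlonglongrightarrow> (INF z\<in>Y. ereal (l \<bullet> z))}"

text \<open>The infimum in \<open>AExp\<close> is the value of the scalarised problem.\<close>

lemma scalar_value_eq_INF:
  assumes "objective_set U f \<subseteq> range ereal_vec"
  shows "scalar_value U f l = (INF z\<in>ereal_vec -` objective_set U f. ereal (l \<bullet> z))"
proof -
  have eq: "(\<Sum>i\<in>UNIV. ereal (l $ i) * f i u) = ereal (l \<bullet> z)"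
    if "(\<chi> i. f i u) = ereal_vec z" for u z
  proof -
    have "f i u = ereal (z $ i)" for i
      using that by (metis ereal_vec_def vec_lambda_beta)
    then show ?thesis by (simp add: inner_vec_def)
  qed
  have "(\<lambda>u. \<Sum>i\<in>UNIV. ereal (l $ i) * f i u) ` U =
      (\<lambda>z. ereal (l \<bullet> z)) ` (ereal_vec -` objective_set U f)" (is "?L = ?R")
  proof (intro equalityI subsetI)
    fix s assume "s \<in> ?L"
    then obtain u where u: "u \<in> U" "s = (\<Sum>i\<in>UNIV. ereal (l $ i) * f i u)" by blast
    then obtain z where z: "(\<chi> i. f i u) = ereal_vec z"
      using assms by (fastforce simp: objective_set_def)
    with u have "z \<in> ereal_vec -` objective_set U f"
      by (force simp: objective_set_def)
    then show "s \<in> ?R" using u eq[OF z] by blast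
  next
    fix s assume "s \<in> ?R"
    then obtain z where z: "ereal_vec z \<in> objective_set U f" "s = ereal (l \<bullet> z)" by blast
    then obtain u where "u \<in> U" "(\<chi> i. f i u) = ereal_vec z"
      by (auto simp: objective_set_def)
    then show "s \<in> ?L" using z eq by force
  qed
  then show ?thesis by (simp add: scalar_value_def)
qed

end

theory Submission
  imports Defs
begin

text \<open>
  The idea is monotonicity of minimisers. A point \<open>y\<close> of \<open>AExp \<lambda> Y\<close> lies in the closure of \<open>Y\<close> and
  satisfies \<open>\<lambda> \<bullet> y \<le> \<lambda> \<bullet> w\<close> for all \<open>w \<in> Y\<close>, hence for all \<open>w\<close> in the closure. If \<open>y\<close> and \<open>y'\<close>
  are such points for \<open>\<lambda>\<close> and \<open>\<lambda>'\<close>, adding the two minimality inequalities gives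
  \<open>(\<lambda>' - \<lambda>) \<bullet> (y' - y) \<le> 0\<close>.

  Fix a coordinate \<open>j\<close> and put \<open>d = e\<^sub>k - e\<^sub>j\<close>. Two distinct points \<open>y\<close>, \<open>z\<close> of \<open>AExp \<lambda> Y\<close> satisfy
  \<open>\<lambda> \<bullet> (y - z) = 0\<close>, and because the weights \<open>\<lambda>\<close> sum to 1, some \<open>k\<close> has
  \<open>d \<bullet> y \<noteq> d \<bullet> z\<close>; up to exchanging the points, rationals \<open>r < s\<close> separate these values,
  \<open>d \<bullet> y \<le> r\<close> and \<open>s \<le> d \<bullet> z\<close>. By monotonicity, for fixed \<open>r < s\<close> a line in direction \<open>d\<close> contains
  at most one such \<open>\<lambda>\<close>. If \<open>y\<close> and \<open>z\<close> are moreover required to lie in a fixed ball, the set of these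
  \<open>\<lambda>\<close> is closed, being a projection along compact sets, so that Fubini's theorem applies and shows
  that it is null (\<open>null_sets_hyperplane_lebesgueI\<close>). The exceptional weights are covered by
  countably many of these sets, one for each choice of \<open>k\<close>, \<open>r\<close>, \<open>s\<close> and the radius of the ball.

  The points of \<open>AExp \<lambda> Y\<close> are supergradients at \<open>\<lambda>\<close> of the concave function \<open>V\<close>, so the argument is
  a proof that \<open>V\<close> has only one of them almost everywhere. It compares the points themselves
  rather than difference quotients of \<open>V\<close>, and so treats the interior and the boundary of the set
  where \<open>V\<close> is finite alike.
\<close>

section \<open>Null sets of the hyperplane\<close>

lemma simplex_chart_fun_upd:
  fixes j k :: "'n::finite"
  assumes "k \<noteq> j"
  shows "simplex_chart j (x(k := t)) =
    simplex_chart j (x(k := s)) + (t - s) *\<^sub>R (axis k 1 - axis j 1)"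
proof -
  have sum: "(\<Sum>i\<in>UNIV - {j}. (x(k := u)) i) = u + (\<Sum>i\<in>UNIV - {j} - {k}. x i)" for u
    using assms by (subst sum.remove[of _ k]) auto
  have "simplex_chart j (x(k := t)) $ i =
    (simplex_chart j (x(k := s)) + (t - s) *\<^sub>R (axis k 1 - axis j 1)) $ i" for i
    using assms unfolding simplex_chart_def sum by (simp add: axis_def)
  then show ?thesis by (simp add: vec_eq_iff)
qed

text \<open>
  Fubini's theorem in the chart that omits \<open>j\<close>: moving the coordinate \<open>k\<close> of the chart moves the point
  along \<open>axis k 1 - axis j 1\<close>, so the inner integral runs over a set with at most one point.
\<close>

lemma null_sets_hyperplane_lebesgueI:
  fixes C :: "(real^'n::finite) set" and j k :: 'n
  assumes kj: "k \<noteq> j" and C: "C \<in> sets borel"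
    and line: "\<And>l t. l \<in> C \<Longrightarrow> l + t *\<^sub>R (axis k 1 - axis j 1) \<in> C \<Longrightarrow> t = 0"
  shows "C \<in> null_sets (hyperplane_lebesgue j)"
proof -
  define R where "R = UNIV - {j, k}"
  have Uj: "UNIV - {j} = insert k R" and R: "finite R" "k \<notin> R"
    using kj by (auto simp: R_def)
  interpret product_sigma_finite "\<lambda>_::'n. lborel :: real measure"
    by standard
  have m: "simplex_chart j \<in> (\<Pi>\<^sub>M i\<in>insert k R. (lborel :: real measure)) \<rightarrow>\<^sub>M borel"
    using simplex_chart_measurable[of j] by (simp only: Uj)
  have ind: "indicator C \<in> borel_measurable borel"
    using C by (rule borel_measurable_indicator)
  have inner: "(\<integral>\<^sup>+ t. indicator C (simplex_chart j (x(k := t))) \<partial>lborel) = 0" for x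
  proof -
    have "\<exists>c. \<forall>t. simplex_chart j (x(k := t)) \<in> C \<longrightarrow> t = c"
      using line simplex_chart_fun_upd[OF kj, of x] by (metis eq_iff_diff_eq_0)
    then obtain c where c: "simplex_chart j (x(k := t)) \<notin> C" if "t \<noteq> c" for t by blast
    have "AE t in lborel. indicator C (simplex_chart j (x(k := t))) = (0::ennreal)"
      using AE_lborel_singleton[of c] by eventually_elim (simp add: c)
    then show ?thesis by (simp cong: nn_integral_cong_AE)
  qed
  have "emeasure (hyperplane_lebesgue j) C = (\<integral>\<^sup>+ y. indicator C y \<partial>hyperplane_lebesgue j)"
    by (rule nn_integral_indicator[symmetric]) (simp add: hyperplane_lebesgue_def C)
  also have "\<dots> = (\<integral>\<^sup>+ x. indicator C (simplex_chart j x) \<partial>(\<Pi>\<^sub>M i\<in>insert k R. lborel))"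
    unfolding hyperplane_lebesgue_def Uj by (rule nn_integral_distr[OF m]) (simp add: ind)
  also have "\<dots> = (\<integral>\<^sup>+ x. \<integral>\<^sup>+ t. indicator C (simplex_chart j (x(k := t))) \<partial>lborel
      \<partial>(\<Pi>\<^sub>M i\<in>R. lborel))"
    by (rule product_nn_integral_insert[OF R measurable_compose[OF m ind]])
  also have "\<dots> = 0" by (simp add: inner)
  finally show ?thesis
    using C by (auto simp: null_sets_def hyperplane_lebesgue_def)
qed

section \<open>Weights with a minimiser in a prescribed set\<close>

text \<open>
  The infimum of \<open>l \<bullet> w\<close> over \<open>Y\<close> may be attained only at a limit point of \<open>Y\<close>, as for the points
  of \<open>AExp\<close>.
\<close>

definition minimised_in :: "'a set \<Rightarrow> 'a set \<Rightarrow> 'a::real_inner set" where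
  "minimised_in K Y = {l. \<exists>y\<in>K \<inter> closure Y. \<forall>w\<in>Y. l \<bullet> y \<le> l \<bullet> w}"

lemma inner_le_closure:
  fixes l :: "'a::real_inner"
  assumes "\<And>w. w \<in> Y \<Longrightarrow> c \<le> l \<bullet> w" "w \<in> closure Y"
  shows "c \<le> l \<bullet> w"
proof -
  have "closed {w. c \<le> l \<bullet> w}" by (intro closed_Collect_le continuous_intros)
  then have "closure Y \<subseteq> {w. c \<le> l \<bullet> w}" using assms(1) by (intro closure_minimal) auto
  then show ?thesis using assms(2) by auto
qed

lemma closed_minimised_in:
  fixes K :: "'a::euclidean_space set"
  assumes "compact K"
  shows "closed (minimised_in K Y)"
proof -
  have "closed (\<Inter>w\<in>Y. {p :: 'a \<times> 'a. snd p \<bullet> fst p \<le> snd p \<bullet> w})"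
    by (intro closed_INT ballI closed_Collect_le continuous_intros)
  from closed_compact_projection[OF compact_Int_closed[OF assms closed_closure[of Y]] this]
  show ?thesis by (simp add: minimised_in_def Bex_def)
qed

text \<open>
  Adding the two minimality inequalities shows that the minimiser can only decrease in direction \<open>d\<close>
  when the weight is moved along \<open>d\<close>. A second weight on the line, on either side of the first,
  therefore contradicts the gap between \<open>r\<close> and \<open>s\<close>.
\<close>

lemma minimised_in_line_unique:
  fixes d :: "'a::real_inner"
  assumes rs: "r < s"
    and K: "\<And>y. y \<in> K \<Longrightarrow> d \<bullet> y \<le> r" and L: "\<And>z. z \<in> L \<Longrightarrow> s \<le> d \<bullet> z"
    and l: "l \<in> minimised_in K Y \<inter> minimised_in L Y"
    and lt: "l + t *\<^sub>R d \<in> minimised_in K Y \<inter> minimised_in L Y"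
  shows "t = 0"
proof -
  have no_increase: "t \<le> 0"
    if ly: "l \<in> minimised_in K Y" and lz: "l + t *\<^sub>R d \<in> minimised_in L Y" for l t
  proof -
    obtain y where y: "y \<in> K" "y \<in> closure Y" "\<And>w. w \<in> Y \<Longrightarrow> l \<bullet> y \<le> l \<bullet> w"
      using ly unfolding minimised_in_def by blast
    obtain z where z: "z \<in> L" "z \<in> closure Y"
      "\<And>w. w \<in> Y \<Longrightarrow> (l + t *\<^sub>R d) \<bullet> z \<le> (l + t *\<^sub>R d) \<bullet> w"
      using lz unfolding minimised_in_def by blast
    have "l \<bullet> y \<le> l \<bullet> z" using y(3) z(2) by (rule inner_le_closure)
    moreover have "(l + t *\<^sub>R d) \<bullet> z \<le> (l + t *\<^sub>R d) \<bullet> y" using z(3) y(2) by (rule inner_le_closure)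
    ultimately have "t * (d \<bullet> z - d \<bullet> y) \<le> 0"
      by (simp add: inner_add_left algebra_simps)
    moreover have "0 < d \<bullet> z - d \<bullet> y" using rs K[OF y(1)] L[OF z(1)] by simp
    ultimately show ?thesis by (simp add: mult_le_0_iff)
  qed
  have "t \<le> 0" using no_increase l lt by blast
  moreover have "- t \<le> 0" using no_increase[of "l + t *\<^sub>R d" "- t"] l lt by simp
  ultimately show ?thesis by simp
qed

text \<open>
  The values \<open>l \<bullet> ys k\<close> converge to the real number \<open>l \<bullet> y\<close>, so the infimum, being their limit as
  well, is finite as soon as \<open>AExp\<close> has a point.
\<close>

lemma AExp_minimiser:
  assumes "y \<in> AExp l Y"
  shows "y \<in> closure Y" and "w \<in> Y \<Longrightarrow> l \<bullet> y \<le> l \<bullet> w"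
proof -
  obtain ys where ys: "\<And>k. ys k \<in> Y" "ys \<longlonglongrightarrow> y"
    and lim: "(\<lambda>k. ereal (l \<bullet> ys k)) \<longlonglongrightarrow> (INF z\<in>Y. ereal (l \<bullet> z))"
    using assms by (auto simp: AExp_def)
  show "y \<in> closure Y" using ys by (auto simp: closure_sequential)
  have "(\<lambda>k. ereal (l \<bullet> ys k)) \<longlonglongrightarrow> ereal (l \<bullet> y)"
    using ys(2) by (intro tendsto_intros)
  then have "ereal (l \<bullet> y) = (INF z\<in>Y. ereal (l \<bullet> z))"
    using lim by (rule LIMSEQ_unique)
  then show "l \<bullet> y \<le> l \<bullet> w" if "w \<in> Y"
    using INF_lower[OF that, of "\<lambda>z. ereal (l \<bullet> z)"] by (metis ereal_less_eq(3))
qed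

section \<open>Uniqueness for almost every weight\<close>

text \<open>
  If all differences \<open>y\<^sub>k - y\<^sub>j\<close> and \<open>z\<^sub>k - z\<^sub>j\<close> agree, then \<open>y - z\<close> is a multiple of \<open>(1, \<dots>, 1)\<close>, and a
  weight vector of total mass 1 sees the factor.
\<close>

lemma eq_if_inner_and_differences_eq:
  fixes y z l :: "real^'n::finite"
  assumes l: "(\<Sum>i\<in>UNIV. l $ i) = 1" and eq: "l \<bullet> y = l \<bullet> z"
    and diff: "\<And>k. (axis k 1 - axis j 1) \<bullet> y = (axis k 1 - axis j 1) \<bullet> z"
  shows "y = z"
proof -
  define c where "c = y $ j - z $ j"
  have c: "y $ k = z $ k + c" for k
    using diff[of k] by (simp add: c_def inner_diff_left inner_axis')
  have "l \<bullet> y = l \<bullet> z + (\<Sum>i\<in>UNIV. l $ i) * c"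
    by (simp add: inner_vec_def c distrib_left sum.distrib sum_distrib_right)
  then have "c = 0" using l eq by simp
  then show ?thesis by (simp add: vec_eq_iff c)
qed

text \<open>
  The bound \<open>real m\<close> on the norm makes both sets of candidate minimisers compact, which is what
  makes the set of weights closed and hence measurable.
\<close>

lemma null_sets_separated_minimisers:
  fixes Y :: "(real^'n::finite) set" and j k :: 'n and r s :: real and m :: nat
  assumes "r < s"
  defines "d \<equiv> axis k 1 - axis j 1"
  shows "minimised_in (cball 0 (real m) \<inter> {y. d \<bullet> y \<le> r}) Y \<inter>
    minimised_in (cball 0 (real m) \<inter> {z. s \<le> d \<bullet> z}) Y \<in> null_sets (hyperplane_lebesgue j)"
    (is "?K \<inter> ?L \<in> _")
proof (cases "k = j")
  case True
  then have "?K \<inter> ?L = {}" using \<open>r < s\<close> by (auto simp: minimised_in_def d_def)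
  then show ?thesis by simp
next
  case False
  have "closed ?K" "closed ?L"
    by (intro closed_minimised_in compact_Int_closed compact_cball closed_Collect_le
      continuous_intros)+
  then have "?K \<inter> ?L \<in> sets borel" by (intro borel_closed closed_Int)
  then show ?thesis
  proof (rule null_sets_hyperplane_lebesgueI[OF False])
    fix l :: "real^'n" and t
    assume "l \<in> ?K \<inter> ?L" "l + t *\<^sub>R (axis k 1 - axis j 1) \<in> ?K \<inter> ?L"
    then show "t = 0"
      unfolding d_def[symmetric]
      by (rule minimised_in_line_unique[OF \<open>r < s\<close>, rotated 2]) auto
  qed
qed

theorem AE_simplex_AExp_unique:
  fixes Y :: "(real^'n::finite) set"
  shows "AE l in simplex_lebesgue. \<forall>y\<in>AExp l Y. \<forall>z\<in>AExp l Y. y = z"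
proof -
  fix j :: 'n
  define d :: "'n \<Rightarrow> real^'n" where "d k = axis k 1 - axis j 1" for k
  define C where "C = (\<lambda>(k, r, s, m). minimised_in (cball 0 (real m) \<inter> {y. d k \<bullet> y \<le> r}) Y \<inter>
    minimised_in (cball 0 (real m) \<inter> {z. s \<le> d k \<bullet> z}) Y)"
  define I :: "('n \<times> real \<times> real \<times> nat) set" where
    "I = {(k, r, s, m). r \<in> \<rat> \<and> s \<in> \<rat> \<and> r < s}"
  have "I \<subseteq> UNIV \<times> \<rat> \<times> \<rat> \<times> UNIV" by (auto simp: I_def)
  then have "countable I"
    by (rule countable_subset) (intro countable_SIGMA countable_rat countableI_type)
  moreover have "C i \<in> null_sets (hyperplane_lebesgue j)" if "i \<in> I" for i
    using that null_sets_separated_minimisers by (auto simp: C_def I_def d_def)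
  ultimately have "AE l in hyperplane_lebesgue j. \<forall>i\<in>I. l \<notin> C i"
    by (simp add: AE_ball_countable AE_not_in)
  then have "AE l in hyperplane_lebesgue j. l \<in> open_simplex \<longrightarrow>
      (\<forall>y\<in>AExp l Y. \<forall>z\<in>AExp l Y. y = z)"
  proof eventually_elim
    case (elim l)
    have not_less: "\<not> d k \<bullet> y < d k \<bullet> z" if y: "y \<in> AExp l Y" and z: "z \<in> AExp l Y" for k y z
    proof
      assume "d k \<bullet> y < d k \<bullet> z"
      then obtain s where s: "s \<in> \<rat>" "d k \<bullet> y < s" "s < d k \<bullet> z"
        using Rats_dense_in_real by blast
      then obtain r where r: "r \<in> \<rat>" "d k \<bullet> y < r" "r < s"
        using Rats_dense_in_real by blast
      obtain m :: nat where "max (norm y) (norm z) \<le> real m" using real_arch_simple by blast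
      then have "l \<in> C (k, r, s, m)"
        using r s AExp_minimiser[OF y] AExp_minimiser[OF z]
        by (fastforce simp: C_def minimised_in_def)
      then show False using elim r s by (auto simp: I_def)
    qed
    show ?case
    proof (intro impI ballI)
      fix y z assume l: "l \<in> open_simplex" and y: "y \<in> AExp l Y" and z: "z \<in> AExp l Y"
      have "l \<bullet> y \<le> l \<bullet> z"
        using AExp_minimiser(2)[OF y] AExp_minimiser(1)[OF z] by (rule inner_le_closure)
      moreover have "l \<bullet> z \<le> l \<bullet> y"
        using AExp_minimiser(2)[OF z] AExp_minimiser(1)[OF y] by (rule inner_le_closure)
      moreover have "d k \<bullet> y = d k \<bullet> z" for k
        using not_less[OF y z, of k] not_less[OF z y, of k] by simp
      ultimately show "y = z"
        using l by (intro eq_if_inner_and_differences_eq[of l y z j])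
          (auto simp: open_simplex_def d_def)
    qed
  qed
  moreover have "open_simplex \<inter> space (hyperplane_lebesgue j) \<in> sets (hyperplane_lebesgue j)"
    by (simp add: hyperplane_lebesgue_def open_simplex_borel)
  ultimately show ?thesis
    unfolding simplex_lebesgue_eq[of j] by (simp add: AE_restrict_space_iff Int_commute)
qed

theorem corollary3p5:
  fixes U :: "'u set" and f :: "'n::finite \<Rightarrow> 'u \<Rightarrow> ereal"
  assumes "CARD('n) \<ge> 2"
    and "U \<noteq> {}"
    and "\<And>i u. u \<in> U \<Longrightarrow> f i u \<noteq> -\<infinity>"
    and "objective_set U f \<subseteq> range ereal_vec"
  shows "AE l in simplex_lebesgue. scalar_value U f l > -\<infinity> \<longrightarrow>
    (\<forall>y\<in>AExp l (ereal_vec -` objective_set U f).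
     \<forall>z\<in>AExp l (ereal_vec -` objective_set U f). y = z)"
  using AE_simplex_AExp_unique[of "ereal_vec -` objective_set U f"]
  by eventually_elim simp

end
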